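(* Let $\tau_{\mathbb{R}}$ be the usual topology of the real line $\mathbb{R}$. There exists a topology $\tau^*$ on $\mathbb{R}$ with $\tau^* \supseteq \tau_{\mathbb{R}}$ such that all of the following hold: (i) $\Delta(\mathbb{R},\tau^* ) = \mathfrak{c}$; (ii) the space $(\mathbb{R},\tau^* )$ has hereditary NDT, i.e. every subspace of $(\mathbb{R},\tau^* )$ has nowhere dense tightness; (iii) $(\mathbb{R},\tau^* )$ is hereditarily $\omega_1$-irresolvable, i.e. no nonempty subspace of $(\mathbb{R},\tau^* )$ is $\omega_1$-resolvable; (iv) furthermore, whenever $(A_\alpha)_{\alpha<\omega_1}$ is a family of pairwise disjoint subsets of $\mathbb{R}$, at least one of the sets $A_\alpha$ has no accumulation points in $(\mathbb{R},\tau^* )$.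
   Context: $\mathfrak{c}=2^{\omega}$. For a subset $A$ of a space $X$, $A'$ denotes the set of accumulation points of $A$: $x\in A'$ iff every neighborhood of $x$ contains a point of $A\setminus\{x\}$. The dispersion character of a space is $\Delta(X)=\min\{|U| : U \text{ is nonempty open in } X\}$. A space $X$ is $\kappa$-resolvable if it contains $\kappa$ many pairwise disjoint dense subsets. A space $X$ has nowhere dense tightness (NDT) if whenever $A\subseteq X$ and $x\in A'$ there is a set $N\subseteq A$ such that $N$ is nowhere dense in $X$ and $x\in N'$. *)

theory Defs
  imports "HOL-Analysis.Analysis"
begin

unbundle cardinal_syntax

definition dense_subset :: "'a topology \<Rightarrow> 'a set \<Rightarrow> bool" where
  "dense_subset X D \<longleftrightarrow> D \<subseteq> topspace X \<and> X closure_of D = topspace X"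

definition nowhere_dense_subset :: "'a topology \<Rightarrow> 'a set \<Rightarrow> bool" where
  "nowhere_dense_subset X N \<longleftrightarrow> N \<subseteq> topspace X \<and> X interior_of (X closure_of N) = {}"

(* Cardinals are cardinal orders up to \<open>=o\<close>. The operator below picks a \<open>\<le>o\<close>-minimum
   of a nonempty collection of well-orders, unique up to \<open>=o\<close>. *)

definition min_cardinal :: "'a rel set \<Rightarrow> 'a rel" where
  "min_cardinal R = (SOME r. r \<in> R \<and> (\<forall>s\<in>R. r \<le>o s))"

definition dispersion_character :: "'a topology \<Rightarrow> 'a rel" where
  "dispersion_character X = min_cardinal {|U| |U. openin X U \<and> U \<noteq> {}}"

definition continuum :: "(nat \<Rightarrow> bool) rel" where
  "continuum = ctwo ^c natLeq"

definition omega_1 :: "nat set rel" where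
  "omega_1 = cardSuc natLeq"

definition resolvable :: "'k rel \<Rightarrow> 'a topology \<Rightarrow> bool" where
  "resolvable \<kappa> X \<longleftrightarrow>
     (\<exists>\<D>. |\<D>| =o \<kappa> \<and> disjoint \<D> \<and> (\<forall>D\<in>\<D>. dense_subset X D))"

definition hereditarily_irresolvable :: "'k rel \<Rightarrow> 'a topology \<Rightarrow> bool" where
  "hereditarily_irresolvable \<kappa> X \<longleftrightarrow>
     (\<forall>S. S \<subseteq> topspace X \<and> S \<noteq> {} \<longrightarrow> \<not> resolvable \<kappa> (subtopology X S))"

definition nowhere_dense_tightness :: "'a topology \<Rightarrow> bool" where
  "nowhere_dense_tightness X \<longleftrightarrow>
     (\<forall>A x. A \<subseteq> topspace X \<and> x \<in> X derived_set_of A \<longrightarrow>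
        (\<exists>N. N \<subseteq> A \<and> nowhere_dense_subset X N \<and> x \<in> X derived_set_of N))"

definition hereditary_nowhere_dense_tightness :: "'a topology \<Rightarrow> bool" where
  "hereditary_nowhere_dense_tightness X \<longleftrightarrow>
     (\<forall>S. S \<subseteq> topspace X \<longrightarrow> nowhere_dense_tightness (subtopology X S))"

lemma dispersion_character_minimum:
  assumes "topspace X \<noteq> {}"
  shows "\<exists>U. openin X U \<and> U \<noteq> {} \<and> dispersion_character X = |U|"
    and "\<And>V. openin X V \<Longrightarrow> V \<noteq> {} \<Longrightarrow> dispersion_character X \<le>o |V|"
proof -
  let ?R = "{|U| |U. openin X U \<and> U \<noteq> {}}"
  have ne: "?R \<noteq> {}" using assms by blast
  have "\<forall>r\<in>?R. Card_order r" by (auto simp: card_of_Card_order)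
  then have "\<exists>r. r \<in> ?R \<and> (\<forall>s\<in>?R. r \<le>o s)"
    using exists_minim_Card_order[OF ne] by blast
  from someI_ex[OF this]
  have *: "dispersion_character X \<in> ?R \<and> (\<forall>s\<in>?R. dispersion_character X \<le>o s)"
    unfolding dispersion_character_def min_cardinal_def .
  show "\<exists>U. openin X U \<and> U \<noteq> {} \<and> dispersion_character X = |U|"
    using * by blast
  show "\<And>V. openin X V \<Longrightarrow> V \<noteq> {} \<Longrightarrow> dispersion_character X \<le>o |V|"
    using * by blast
qed

end

(* Fix a map phi from the reals to the finite sets of naturals all of whose fibres meet every
   interval in continuum many points.  The cells {x : V. K <= phi x, phi x disjoint from J}, with V
   open and K, J finite and disjoint, are determined up to shrinking by countably many data.  Let DD
   be a maximal filter of sets meeting every cell in continuum many points, and let the topology be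
   generated by the open sets V, the sets {x. n : phi x} and the members of DD.

   By maximality, a set A with an accumulation point contains the trace D Int C of a cell C on
   some D : DD.  Two traces of the same cell always meet, so among uncountably many disjoint sets one
   has no accumulation point.  The traces are themselves not discrete: forbidding a further index j
   (J := J Un {j}) cuts out a nowhere dense part of a cell which still accumulates at all its points. *)

theory Submission
  imports Defs
begin

section \<open>Sets of fewer than continuum many reals\<close>

definition small :: "real set \<Rightarrow> bool" where
  "small A \<longleftrightarrow> |A| <o |UNIV :: real set|"

lemma countable_iff_card_of_ordLeq: "countable A \<longleftrightarrow> |A| \<le>o |UNIV :: nat set|"
  unfolding countable_def card_of_ordLeq[symmetric] by simp

lemma small_subset: "small B \<Longrightarrow> A \<subseteq> B \<Longrightarrow> small A"
  unfolding small_def using card_of_mono1 ordLeq_ordLess_trans by blast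

lemma small_countable: "countable A \<Longrightarrow> small A"
  unfolding small_def
  by (metis card_of_ordLess countable_subset countable_image_inj_on uncountable_UNIV_real)

lemma small_Un: "small A \<Longrightarrow> small B \<Longrightarrow> small (A \<union> B)"
  unfolding small_def by (intro card_of_Un_ordLess_infinite infinite_UNIV_char_0)

lemma not_small_Diff: "\<not> small A \<Longrightarrow> small B \<Longrightarrow> \<not> small (A - B)"
  using small_Un small_subset by (metis Diff_subset_conv order_refl)

lemma not_small_obtains:
  assumes "\<not> small A" obtains y where "y \<in> A" "y \<noteq> x"
  using assms small_countable[of "{x}"] small_subset[of "{x}" A] by auto

text \<open>An infinite \<open>B\<close> absorbs the countable factor, while a finite
  \<open>B\<close> gives a countable product. This makes it possible to count reals through
  representatives of the cosets of the rationals.\<close>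

lemma small_Times_Rats:
  assumes "small B" shows "|B \<times> (\<rat> :: real set)| <o |UNIV :: real set|"
proof (cases "finite B")
  case True
  then have "countable (B \<times> (\<rat> :: real set))"
    by (simp add: countable_finite countable_rat)
  then show ?thesis
    by (metis card_of_ordLess countable_subset countable_image_inj_on uncountable_UNIV_real)
next
  case False
  have "|\<rat> :: real set| \<le>o |B|"
    using False countable_rat
    by (meson countable_iff_card_of_ordLeq infinite_iff_card_of_nat ordLeq_transitive)
  then have "|B \<times> (\<rat> :: real set)| =o |B|"
    using card_of_Times_infinite[OF False, of "\<rat> :: real set"] Rats_0 by auto
  then show ?thesis
    using assms ordIso_ordLess_trans unfolding small_def by blast
qed

lemma reals_continuum: "|UNIV :: real set| =o continuum"
proof -
  have "|UNIV :: real set| =o |UNIV :: nat set set|"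
    using nat_sets_eqpoll_reals eqpoll_iff_card_of_ordIso ordIso_symmetric by blast
  moreover have "bij_betw (\<lambda>A n. n \<in> A) (UNIV :: nat set set) (UNIV :: (nat \<Rightarrow> bool) set)"
    by (rule bij_betwI[where g = Collect]) auto
  then have "|UNIV :: nat set set| =o |UNIV :: (nat \<Rightarrow> bool) set|"
    by (rule card_of_ordIsoI)
  moreover have "continuum = |UNIV :: (nat \<Rightarrow> bool) set|"
    unfolding continuum_def cexp_def ctwo_def
    by (simp add: Field_card_of Field_natLeq Func_def)
  ultimately show ?thesis
    using ordIso_transitive by metis
qed

section \<open>A labelling of the reals by finite sets\<close>

text \<open>This is density of the coset of \<open>z\<close>: a representative can be moved into
  \<open>V\<close> without leaving its coset.\<close>

lemma Rats_translate_meets_open: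
  fixes V :: "real set"
  assumes "open V" "V \<noteq> {}"
  obtains y where "y \<in> V" "y - z \<in> \<rat>"
proof -
  obtain v e where v: "e > 0" "ball v e \<subseteq> V"
    using assms openE by blast
  then obtain q where q: "q \<in> \<rat>" "v - z < q" "q < v - z + e"
    using Rats_dense_in_real[of "v - z" "v - z + e"] by auto
  then have "z + q \<in> V"
    using v by (intro subsetD[OF v(2)]) (auto simp: dist_real_def)
  then show ?thesis
    using that[of "z + q"] q(1) by simp
qed

text \<open>The labelling is constant on the cosets of the rationals, with as many cosets for each label
  as there are in total.\<close>

lemma ex_labelling_nat:
  "\<exists>f :: real \<Rightarrow> nat. \<forall>n V. open V \<longrightarrow> V \<noteq> {} \<longrightarrow> \<not> small {x \<in> V. f x = n}"
proof -
  \<comment> \<open>Points of one coset present the same predicate to \<open>SOME\<close>, so they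
    receive the same representative.\<close>
  define rep where "rep x = (SOME y :: real. x - y \<in> \<rat>)" for x
  have rep: "x - rep x \<in> \<rat>" for x
    using someI[of "\<lambda>y. x - y \<in> \<rat>" x] by (simp add: rep_def)
  have rep_eq: "rep x = rep y" if "x - y \<in> \<rat>" for x y
  proof -
    have "x - z \<in> \<rat> \<longleftrightarrow> y - z \<in> \<rat>" for z
    proof
      assume "x - z \<in> \<rat>"
      from Rats_diff[OF this that] show "y - z \<in> \<rat>" by simp
    next
      assume "y - z \<in> \<rat>"
      from Rats_add[OF that this] show "x - z \<in> \<rat>" by simp
    qed
    then show ?thesis
      unfolding rep_def by simp
  qed
  define R where "R = range rep"
  have rep_R: "rep r = r" if "r \<in> R" for r
    using that rep_eq[OF rep] unfolding R_def by auto
  \<comment> \<open>A real is its representative plus a rational offset, so \<open>R\<close> times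
    the rationals is at least as large as the line.\<close>
  have inj: "inj (\<lambda>x. (rep x, x - rep x))"
    by (rule injI) simp
  have "\<not> small R"
  proof
    assume "small R"
    then have "|R \<times> (\<rat> :: real set)| <o |UNIV :: real set|"
      by (rule small_Times_Rats)
    moreover have "|UNIV :: real set| \<le>o |R \<times> (\<rat> :: real set)|"
      by (rule card_of_ordLeqI[OF inj]) (simp add: R_def rep)
    ultimately show False
      by (simp add: not_ordLess_ordLeq)
  qed
  then have "infinite R"
    using small_countable countable_finite by blast
  then have "|R \<times> (UNIV :: nat set)| =o |R|"
    using card_of_Times_infinite[of R "UNIV :: nat set"] infinite_iff_card_of_nat by auto
  then obtain h where h: "bij_betw h (R \<times> (UNIV :: nat set)) R"
    using card_of_ordIso by blast
  \<comment> \<open>\<open>h\<close> splits \<open>R\<close> into countably many pieces of size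
    \<open>|R|\<close>, one for each second coordinate; that coordinate becomes the label of the
    coset.\<close>
  define f where "f x = snd (inv_into (R \<times> UNIV) h (rep x))" for x
  have "\<not> small {x \<in> V. f x = n}" if V: "open V" "V \<noteq> {}" for n V
  proof
    assume sm: "small {x \<in> V. f x = n}"
    have "\<exists>y. y \<in> V \<and> y - h (r, n) \<in> \<rat>" for r
      using Rats_translate_meets_open[OF V, of "h (r, n)"] by blast
    \<comment> \<open>For \<open>r\<close> in \<open>R\<close>, \<open>p r\<close> is a point of
      \<open>V\<close> in the coset of \<open>h (r, n)\<close>, so its label is
      \<open>n\<close>.\<close>
    then obtain p where p: "\<And>r. p r \<in> V" "\<And>r. p r - h (r, n) \<in> \<rat>"
      by metis
    have rp: "rep (p r) = h (r, n)" if "r \<in> R" for r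
    proof -
      have "h (r, n) \<in> R"
        using h that by (auto simp: bij_betw_def)
      then show ?thesis
        using rep_eq[OF p(2)[of r]] rep_R by simp
    qed
    have inv: "inv_into (R \<times> UNIV) h (rep (p r)) = (r, n)" if "r \<in> R" for r
      using rp[OF that] h that by (simp add: bij_betw_def inv_into_f_f)
    \<comment> \<open>\<open>inv\<close> recovers \<open>r\<close> from \<open>p r\<close>, so the
      whole line embeds into the points of \<open>V\<close> labelled \<open>n\<close> times the
      rationals.\<close>
    have inj_p: "inj (\<lambda>x. (p (rep x), x - rep x))"
    proof (rule injI)
      fix x y assume eq: "(p (rep x), x - rep x) = (p (rep y), y - rep y)"
      then have "p (rep x) = p (rep y)" by blast
      moreover have "rep x \<in> R" "rep y \<in> R" by (simp_all add: R_def)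
      ultimately have "rep x = rep y"
        using inv by (metis prod.inject)
      with eq show "x = y" by simp
    qed
    have "p (rep x) \<in> {x \<in> V. f x = n}" for x
    proof -
      have "rep x \<in> R" by (simp add: R_def)
      from inv[OF this] have "f (p (rep x)) = n" by (simp add: f_def)
      with p(1) show ?thesis by simp
    qed
    then have "|UNIV :: real set| \<le>o |{x \<in> V. f x = n} \<times> (\<rat> :: real set)|"
      by (intro card_of_ordLeqI[OF inj_p] SigmaI rep)
    with small_Times_Rats[OF sm] show False
      by (simp add: not_ordLess_ordLeq)
  qed
  then show ?thesis by blast
qed

text \<open>Binary coding by \<open>set_decode\<close> and \<open>set_encode\<close> turns numerical
  labels into finite sets, and every finite set has a code.\<close>

lemma ex_labelling_finite_sets:
  "\<exists>\<phi> :: real \<Rightarrow> nat set. (\<forall>x. finite (\<phi> x)) \<and>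
     (\<forall>K V. finite K \<longrightarrow> open V \<longrightarrow> V \<noteq> {} \<longrightarrow> \<not> small {x \<in> V. \<phi> x = K})"
proof -
  obtain f :: "real \<Rightarrow> nat" where f: "\<And>n V. open V \<Longrightarrow> V \<noteq> {} \<Longrightarrow> \<not> small {x \<in> V. f x = n}"
    using ex_labelling_nat by blast
  have "\<not> small {x \<in> V. set_decode (f x) = K}" if "finite K" "open V" "V \<noteq> {}" for K V
  proof -
    have "{x \<in> V. f x = set_encode K} \<subseteq> {x \<in> V. set_decode (f x) = K}"
      using that(1) by auto
    then show ?thesis
      using f[OF that(2,3)] small_subset by blast
  qed
  then show ?thesis
    by (intro exI[of _ "\<lambda>x. set_decode (f x)"]) auto
qed

section \<open>Maximal filters from Zorn's lemma\<close>

text \<open>The conditions in \<open>F\<close> involve at most two members at a time, so they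
  survive unions of chains. A maximal \<open>M\<close> absorbs every admissible \<open>E\<close>,
  since adjoining all \<open>E \<inter> D\<close> keeps the family in \<open>F\<close>. Upward
  closure comes later, from maximality and monotonicity of \<open>large\<close>.\<close>

lemma ex_maximal_filter:
  fixes P :: "'a set \<Rightarrow> bool"
  assumes "P UNIV"
  shows "\<exists>\<D>. (\<forall>D\<in>\<D>. P D) \<and> (\<forall>D\<in>\<D>. \<forall>E\<in>\<D>. D \<inter> E \<in> \<D>) \<and>
           (\<forall>E. (\<forall>D\<in>\<D>. P (E \<inter> D)) \<longrightarrow> E \<in> \<D>)"
proof -
  define F where "F = {\<D>. UNIV \<in> \<D> \<and> (\<forall>D\<in>\<D>. P D) \<and> (\<forall>D\<in>\<D>. \<forall>E\<in>\<D>. D \<inter> E \<in> \<D>)}"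
  have FI: "\<D> \<in> F" if "UNIV \<in> \<D>" "\<And>D. D \<in> \<D> \<Longrightarrow> P D" "\<And>D E. D \<in> \<D> \<Longrightarrow> E \<in> \<D> \<Longrightarrow> D \<inter> E \<in> \<D>" for \<D>
    using that unfolding F_def by blast
  have FD: "UNIV \<in> \<D>" "\<And>D. D \<in> \<D> \<Longrightarrow> P D" "\<And>D E. D \<in> \<D> \<Longrightarrow> E \<in> \<D> \<Longrightarrow> D \<inter> E \<in> \<D>" if "\<D> \<in> F" for \<D>
    using that unfolding F_def by blast+
  have "\<exists>M\<in>F. \<forall>X\<in>F. M \<subseteq> X \<longrightarrow> X = M"
  proof (rule subset_Zorn_nonempty)
    have "{UNIV} \<in> F"
      using assms by (simp add: F_def)
    then show "F \<noteq> {}" by blast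
  next
    fix \<C> assume ne: "\<C> \<noteq> {}" and ch: "subset.chain F \<C>"
    have sub: "\<C> \<subseteq> F"
      using ch by (simp add: subset_chain_def)
    show "\<Union>\<C> \<in> F"
    proof (rule FI)
      obtain X where "X \<in> \<C>"
        using ne by blast
      then show "UNIV \<in> \<Union>\<C>"
        using sub FD(1) by blast
    next
      fix D assume "D \<in> \<Union>\<C>"
      then show "P D"
        using sub FD(2) by blast
    next
      fix D E assume "D \<in> \<Union>\<C>" "E \<in> \<Union>\<C>"
      then obtain X Y where XY: "X \<in> \<C>" "Y \<in> \<C>" "D \<in> X" "E \<in> Y"
        by blast
      then have "X \<subseteq> Y \<or> Y \<subseteq> X"
        using ch by (auto simp: subset_chain_def)
      then obtain Z where "Z \<in> \<C>" "D \<in> Z" "E \<in> Z"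
        using XY by blast
      then show "D \<inter> E \<in> \<Union>\<C>"
        using sub FD(3)[of Z D E] by blast
    qed
  qed
  then obtain M where M: "M \<in> F" and max: "\<And>X. X \<in> F \<Longrightarrow> M \<subseteq> X \<Longrightarrow> X = M"
    by blast
  have "E \<in> M" if E: "\<And>D. D \<in> M \<Longrightarrow> P (E \<inter> D)" for E
  proof -
    let ?X = "M \<union> (\<lambda>D. E \<inter> D) ` M"
    have "?X \<in> F"
    proof (rule FI)
      show "UNIV \<in> ?X"
        using FD(1)[OF M] by (rule UnI1)
    next
      fix D assume "D \<in> ?X"
      then show "P D"
        using FD(2)[OF M] E by (elim UnE imageE) simp_all
    next
      fix A B assume "A \<in> ?X" "B \<in> ?X"
      moreover have "A \<inter> B \<in> M" if "A \<in> M" "B \<in> M" for A B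
        using FD(3)[OF M that] .
      moreover have "A \<inter> (E \<inter> B) = E \<inter> (A \<inter> B)" "(E \<inter> A) \<inter> (E \<inter> B) = E \<inter> (A \<inter> B)" for A B
        by blast+
      ultimately show "A \<inter> B \<in> ?X"
        by (elim UnE imageE) (simp_all add: Int_assoc)
    qed
    then have "?X = M"
      using max by blast
    \<comment> \<open>The choice \<open>D = UNIV\<close> puts \<open>E\<close> itself into the
      enlarged family.\<close>
    moreover have "E \<inter> UNIV \<in> ?X"
      using FD(1)[OF M] by (intro UnI2 imageI)
    ultimately show ?thesis by simp
  qed
  then have "\<forall>E. (\<forall>D\<in>M. P (E \<inter> D)) \<longrightarrow> E \<in> M"
    by blast
  moreover have "\<forall>D\<in>M. P D" "\<forall>D\<in>M. \<forall>E\<in>M. D \<inter> E \<in> M"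
    using M unfolding F_def by blast+
  ultimately show ?thesis
    by (intro exI[of _ M] conjI)
qed

section \<open>Cells and large sets\<close>

text \<open>With \<open>V\<close> open, \<open>K\<close> finite and \<open>J = {}\<close> these sets
  will be open in the fine topology. Forbidding an index in \<open>J\<close> leaves no interior,
  because each nonempty basic open set has points carrying any given index.\<close>

definition cell :: "(real \<Rightarrow> nat set) \<Rightarrow> real set \<Rightarrow> nat set \<Rightarrow> nat set \<Rightarrow> real set" where
  "cell \<phi> V K J = {x \<in> V. K \<subseteq> \<phi> x \<and> \<phi> x \<inter> J = {}}"

definition large :: "(real \<Rightarrow> nat set) \<Rightarrow> real set \<Rightarrow> bool" where
  "large \<phi> D \<longleftrightarrow> (\<forall>V K J. open V \<and> V \<noteq> {} \<and> finite K \<and> finite J \<and> K \<inter> J = {} \<longrightarrow>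
     \<not> small (D \<inter> cell \<phi> V K J))"

lemma large_mono: "large \<phi> D \<Longrightarrow> D \<subseteq> E \<Longrightarrow> large \<phi> E"
  unfolding large_def by (metis Int_mono order_refl small_subset)

lemma large_Diff_small:
  assumes "large \<phi> D" "small B" shows "large \<phi> (D - B)"
  unfolding large_def
proof (intro allI impI)
  fix V :: "real set" and K J :: "nat set"
  assume "open V \<and> V \<noteq> {} \<and> finite K \<and> finite J \<and> K \<inter> J = {}"
  then have "\<not> small (D \<inter> cell \<phi> V K J - B)"
    using assms not_small_Diff unfolding large_def by blast
  moreover have "(D - B) \<inter> cell \<phi> V K J = D \<inter> cell \<phi> V K J - B"
    by blast
  ultimately show "\<not> small ((D - B) \<inter> cell \<phi> V K J)"
    by simp
qed

section \<open>The fine topology and its dispersion character\<close>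

text \<open>Apart from finiteness of the labels, the assumptions are what
  \<open>ex_maximal_filter\<close> yields for \<open>large \<phi>\<close>.\<close>

locale fine_topology =
  fixes \<phi> :: "real \<Rightarrow> nat set" and \<D> :: "real set set"
  assumes finite_label: "finite (\<phi> x)"
    and large: "D \<in> \<D> \<Longrightarrow> large \<phi> D"
    and Int_mem: "D \<in> \<D> \<Longrightarrow> E \<in> \<D> \<Longrightarrow> D \<inter> E \<in> \<D>"
    and maximal: "(\<And>D. D \<in> \<D> \<Longrightarrow> large \<phi> (E \<inter> D)) \<Longrightarrow> E \<in> \<D>"
begin

lemma UNIV_mem: "UNIV \<in> \<D>"
  by (rule maximal) (simp add: large)

lemma superset_mem:
  assumes "D \<in> \<D>" "D \<subseteq> E" shows "E \<in> \<D>"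
proof (rule maximal)
  fix D' assume "D' \<in> \<D>"
  then show "large \<phi> (E \<inter> D')"
    using assms Int_mem[of D D'] large[of "D \<inter> D'"] large_mono[of \<phi> "D \<inter> D'" "E \<inter> D'"] by blast
qed

lemma Diff_small_mem:
  assumes "D \<in> \<D>" "small B" shows "D - B \<in> \<D>"
proof (rule maximal)
  fix D' assume "D' \<in> \<D>"
  then have "large \<phi> (D \<inter> D' - B)"
    using assms Int_mem[of D D'] large[of "D \<inter> D'"] large_Diff_small by blast
  moreover have "D \<inter> D' - B = (D - B) \<inter> D'" by blast
  ultimately show "large \<phi> ((D - B) \<inter> D')" by simp
qed

text \<open>The point \<open>y\<close> certifies that the cell is one to which \<open>large\<close>
  applies: \<open>V\<close> is nonempty and \<open>K\<close>, \<open>J\<close> are disjoint.\<close>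

lemma not_small_cell:
  assumes "D \<in> \<D>" "open V" "finite K" "finite J" "y \<in> cell \<phi> V K J"
  shows "\<not> small (D \<inter> cell \<phi> V K J)"
proof -
  have "V \<noteq> {}" "K \<inter> J = {}"
    using assms(5) unfolding cell_def by auto
  then show ?thesis
    using large[OF assms(1)] assms(2-4) unfolding large_def by blast
qed

text \<open>By maximality \<open>- A\<close> fails to be large on some \<open>D\<close>, so in some
  cell only a small part of \<open>D\<close> lies outside \<open>A\<close>. Deleting that part from
  \<open>D\<close> stays inside \<open>\<D>\<close>.\<close>

lemma trace_if_Compl_notin:
  assumes "- A \<notin> \<D>"
  obtains D V K J where "D \<in> \<D>" "open V" "V \<noteq> {}" "finite K" "finite J" "K \<inter> J = {}"
    "D \<inter> cell \<phi> V K J \<subseteq> A"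
proof -
  obtain D where D: "D \<in> \<D>" "\<not> large \<phi> (- A \<inter> D)"
    using assms maximal by blast
  then obtain V K J where VKJ: "open V" "V \<noteq> {}" "finite K" "finite J" "K \<inter> J = {}"
      "small (- A \<inter> D \<inter> cell \<phi> V K J)"
    unfolding large_def by blast
  have "D - (- A \<inter> D \<inter> cell \<phi> V K J) \<in> \<D>"
    using D(1) VKJ(6) by (rule Diff_small_mem)
  moreover have "(D - (- A \<inter> D \<inter> cell \<phi> V K J)) \<inter> cell \<phi> V K J \<subseteq> A"
    by blast
  ultimately show thesis
    using that VKJ by blast
qed

definition T :: "real topology" where
  "T = topology (\<lambda>U. \<forall>x\<in>U. \<exists>V K D. open V \<and> finite K \<and> D \<in> \<D> \<and>
         x \<in> D \<inter> cell \<phi> V K {} \<and> D \<inter> cell \<phi> V K {} \<subseteq> U)"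

lemma openin_T:
  "openin T U \<longleftrightarrow> (\<forall>x\<in>U. \<exists>V K D. open V \<and> finite K \<and> D \<in> \<D> \<and>
     x \<in> D \<inter> cell \<phi> V K {} \<and> D \<inter> cell \<phi> V K {} \<subseteq> U)" (is "_ \<longleftrightarrow> ?P U")
proof -
  have Int: "?P (U \<inter> W)" if U: "?P U" and W: "?P W" for U W
  proof
    fix x assume "x \<in> U \<inter> W"
    then obtain V K D V' K' D' where
      "open V" "finite K" "D \<in> \<D>" "x \<in> D \<inter> cell \<phi> V K {}" "D \<inter> cell \<phi> V K {} \<subseteq> U"
      "open V'" "finite K'" "D' \<in> \<D>" "x \<in> D' \<inter> cell \<phi> V' K' {}" "D' \<inter> cell \<phi> V' K' {} \<subseteq> W"
      using U W by (metis IntD1 IntD2)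
    then show "\<exists>V K D. open V \<and> finite K \<and> D \<in> \<D> \<and>
        x \<in> D \<inter> cell \<phi> V K {} \<and> D \<inter> cell \<phi> V K {} \<subseteq> U \<inter> W"
      \<comment> \<open>Two basic sets meet in a basic set: open sets and filter members intersect,
        required indices unite.\<close>
      by (intro exI[of _ "V \<inter> V'"] exI[of _ "K \<union> K'"] exI[of _ "D \<inter> D'"])
        (auto simp: Int_mem cell_def)
  qed
  have "?P (\<Union>\<K>)" if "\<forall>U\<in>\<K>. ?P U" for \<K>
    using that by (meson UnionE Union_upper order_trans)
  then have "istopology ?P"
    unfolding istopology_def using Int by blast
  then show ?thesis
    unfolding T_def by simp
qed

lemma openin_T_obtains:
  assumes "openin T U" "x \<in> U"
  obtains V K D where "open V" "finite K" "D \<in> \<D>" "x \<in> D \<inter> cell \<phi> V K {}"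
    "D \<inter> cell \<phi> V K {} \<subseteq> U"
  using bspec[OF iffD1[OF openin_T assms(1)] assms(2)] that by (elim exE conjE)

lemma openin_T_basic:
  "open V \<Longrightarrow> finite K \<Longrightarrow> D \<in> \<D> \<Longrightarrow> openin T (D \<inter> cell \<phi> V K {})"
  unfolding openin_T by blast

lemma openin_T_open: "open U \<Longrightarrow> openin T U"
  using openin_T_basic[of U "{}" UNIV] UNIV_mem by (simp add: cell_def)

lemma topspace_T: "topspace T = UNIV"
  using openin_T_open[of UNIV] openin_subset by blast

lemma not_small_openin:
  assumes "openin T U" "U \<noteq> {}" shows "\<not> small U"
proof -
  obtain x where "x \<in> U" using assms by blast
  with assms(1) obtain V K D where "open V" "finite K" "D \<in> \<D>" "x \<in> D \<inter> cell \<phi> V K {}"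
      "D \<inter> cell \<phi> V K {} \<subseteq> U"
    by (rule openin_T_obtains)
  then show ?thesis
    using not_small_cell[of D V K "{}" x] small_subset by blast
qed

lemma dispersion_character_T: "dispersion_character T =o continuum"
proof -
  obtain U where U: "openin T U" "U \<noteq> {}" "dispersion_character T = |U|"
    using dispersion_character_minimum(1)[of T] topspace_T by auto
  have "|UNIV :: real set| \<le>o |U|"
    using not_small_openin[OF U(1,2)] unfolding small_def
    by (meson card_of_Well_order ordLess_or_ordLeq)
  then have "|U| =o |UNIV :: real set|"
    by (simp add: card_of_mono1 ordIso_iff_ordLeq)
  then show ?thesis
    using U(3) reals_continuum ordIso_transitive by metis
qed

section \<open>Accumulation points and nowhere dense tightness\<close>

text \<open>Were the complement in \<open>\<D>\<close>, adjoining \<open>x\<close> and cutting with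
  the cell would give a neighbourhood of \<open>x\<close> meeting \<open>A\<close> at most in
  \<open>x\<close>.\<close>

lemma Compl_notin_if_derived:
  assumes "x \<in> T derived_set_of A" "open V" "finite K" "x \<in> cell \<phi> V K {}"
  shows "- (A \<inter> cell \<phi> V K {}) \<notin> \<D>"
proof
  let ?D = "insert x (- (A \<inter> cell \<phi> V K {}))"
  assume "- (A \<inter> cell \<phi> V K {}) \<in> \<D>"
  then have "?D \<in> \<D>"
    by (rule superset_mem) blast
  then have "openin T (?D \<inter> cell \<phi> V K {})"
    using assms by (intro openin_T_basic)
  moreover have "x \<in> ?D \<inter> cell \<phi> V K {}"
    using assms(4) by blast
  moreover have "\<forall>W. x \<in> W \<and> openin T W \<longrightarrow> (\<exists>y\<noteq>x. y \<in> A \<and> y \<in> W)"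
    using assms(1) by (simp add: in_derived_set_of)
  ultimately have "\<exists>y\<noteq>x. y \<in> A \<and> y \<in> ?D \<inter> cell \<phi> V K {}"
    by metis
  then show False by blast
qed

text \<open>N is the union of nowhere dense parts of traces inside A, taken over disjoint annuli shrinking to x:
  disjointness keeps the union nowhere dense, and requiring K to contain \<phi> x for each of the cells makes
  every neighbourhood of x absorb all but finitely many of them.\<close>

lemma obtains_relatively_nowhere_dense:
  assumes x: "x \<in> T derived_set_of A"
  obtains N where "N \<subseteq> A" "x \<in> T derived_set_of N"
    "\<And>U. openin T U \<Longrightarrow> U \<inter> N \<noteq> {} \<Longrightarrow>
       \<exists>W. openin T W \<and> W \<subseteq> U \<and> W \<inter> A \<noteq> {} \<and> W \<inter> N = {}"
proof -
  \<comment> \<open>\<open>Q\<close> describes one piece: a trace inside \<open>A\<close> lying over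
    the annulus with radii \<open>\<delta>\<close> and \<open>\<epsilon>\<close>, whose required
    indices include \<open>\<phi> x\<close>.\<close>
  define Q where "Q \<epsilon> \<delta> D V K J \<longleftrightarrow> 0 < \<delta> \<and> D \<in> \<D> \<and> open V \<and> V \<noteq> {} \<and>
      V \<subseteq> {y. \<delta> < \<bar>y - x\<bar> \<and> \<bar>y - x\<bar> < \<epsilon>} \<and> finite K \<and> finite J \<and> K \<inter> J = {} \<and> \<phi> x \<subseteq> K \<and>
      D \<inter> cell \<phi> V K J \<subseteq> A" for \<epsilon> \<delta> D V K J
  have "\<exists>\<delta> D V K J. Q \<epsilon> \<delta> D V K J" if "\<epsilon> > 0" for \<epsilon>
  proof -
    let ?B = "cell \<phi> (ball x \<epsilon>) (\<phi> x) {}"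
    have "x \<in> ?B"
      using that by (simp add: cell_def)
    then have "- (A \<inter> ?B) \<notin> \<D>"
      using x finite_label by (intro Compl_notin_if_derived) auto
    then obtain D V K J where D: "D \<in> \<D>" "open V" "V \<noteq> {}" "finite K" "finite J" "K \<inter> J = {}"
        "D \<inter> cell \<phi> V K J \<subseteq> A \<inter> ?B"
      by (rule trace_if_Compl_notin)
    then have "\<not> small (D \<inter> cell \<phi> V K J)"
      using large unfolding large_def by blast
    then obtain y where y: "y \<in> D \<inter> cell \<phi> V K J" "y \<noteq> x"
      by (rule not_small_obtains)
    then have yB: "y \<in> ?B"
      using D by blast
    \<comment> \<open>Half the distance from \<open>x\<close> to \<open>y\<close> keeps
      \<open>y\<close> in the annulus, so the shrunken open set is nonempty. The label of
      \<open>y\<close> contains \<open>\<phi> x\<close> and avoids \<open>J\<close>, so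
      \<open>\<phi> x\<close> may join \<open>K\<close>.\<close>
    let ?\<delta> = "\<bar>y - x\<bar> / 2"
    let ?V = "V \<inter> {y. ?\<delta> < \<bar>y - x\<bar> \<and> \<bar>y - x\<bar> < \<epsilon>}"
    have "open {y. ?\<delta> < \<bar>y - x\<bar> \<and> \<bar>y - x\<bar> < \<epsilon>}"
      by (intro open_Collect_conj open_Collect_less continuous_intros)
    moreover have "y \<in> ?V" "\<phi> x \<inter> J = {}"
      using y yB by (auto simp: cell_def dist_real_def abs_minus_commute)
    moreover have "D \<inter> cell \<phi> ?V (K \<union> \<phi> x) J \<subseteq> A"
      using D(7) by (auto simp: cell_def)
    ultimately have "Q \<epsilon> ?\<delta> D ?V (K \<union> \<phi> x) J"
      using D y(2) finite_label[of x] unfolding Q_def by (intro conjI open_Int) auto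
    then show ?thesis by blast
  qed
  then obtain \<delta> Df Vf Kf Jf where piece: "\<And>\<epsilon>. \<epsilon> > 0 \<Longrightarrow> Q \<epsilon> (\<delta> \<epsilon>) (Df \<epsilon>) (Vf \<epsilon>) (Kf \<epsilon>) (Jf \<epsilon>)"
    by metis
  then have \<delta>_pos: "\<epsilon> > 0 \<Longrightarrow> \<delta> \<epsilon> > 0" for \<epsilon>
    unfolding Q_def by blast
  \<comment> \<open>The next outer radius is at most the current inner one, which separates the
    annuli, and at most \<open>1 / (n + 1)\<close>, which shrinks them to \<open>x\<close>.\<close>
  define r where "r = rec_nat 1 (\<lambda>n \<epsilon>. min (\<delta> \<epsilon>) (1 / real (n + 1)))"
  have r_Suc: "r (Suc n) = min (\<delta> (r n)) (1 / real (n + 1))" for n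
    by (simp add: r_def)
  have r_pos: "r n > 0" for n
  proof (induction n)
    case 0
    show ?case by (simp add: r_def)
  next
    case (Suc n)
    then show ?case by (simp add: r_Suc \<delta>_pos)
  qed
  define D V K J where "D n = Df (r n)" and "V n = Vf (r n)" and "K n = Kf (r n)" and "J n = Jf (r n)" for n
  have "Q (r n) (\<delta> (r n)) (D n) (V n) (K n) (J n)" for n
    unfolding D_def V_def K_def J_def by (rule piece[OF r_pos])
  then have D: "D n \<in> \<D>" and V: "open (V n)" "V n \<noteq> {}" and
    V_annulus: "V n \<subseteq> {y. \<delta> (r n) < \<bar>y - x\<bar> \<and> \<bar>y - x\<bar> < r n}" and
    K: "finite (K n)" "\<phi> x \<subseteq> K n" and J: "finite (J n)" and KJ: "K n \<inter> J n = {}" and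
    sub: "D n \<inter> cell \<phi> (V n) (K n) (J n) \<subseteq> A" for n
    unfolding Q_def by blast+
  have VD: "r (Suc n) < \<bar>y - x\<bar> \<and> \<bar>y - x\<bar> < r n" if "y \<in> V n" for y n
    using V_annulus[of n] that r_Suc[of n] by auto
  \<comment> \<open>A point of the nonempty \<open>V n\<close> lies at a distance strictly between
    the two radii.\<close>
  have "r (Suc n) \<le> r n" for n
    using V(2)[of n] VD[of _ n] by fastforce
  then have r_antimono: "r n \<le> r m" if "m \<le> n" for m n
    using lift_Suc_antimono_le[of r m n] that by blast
  have disj: "m = n" if "y \<in> V m" "y \<in> V n" for y m n
    using VD[OF that(1)] VD[OF that(2)] r_antimono[of "Suc m" n] r_antimono[of "Suc n" m]
    by (cases m n rule: linorder_cases) auto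
  have "\<exists>j. j \<notin> K n \<union> J n" for n
    using K(1) J by (intro ex_new_if_finite) auto
  then obtain j where j: "\<And>n. j n \<notin> K n \<union> J n"
    by metis
  \<comment> \<open>Forbidding the fresh index \<open>j n\<close> thins out the \<open>n\<close>-th
    trace; the deleted points, those carrying \<open>j n\<close>, still belong to
    \<open>A\<close>.\<close>
  define N where "N = (\<Union>n. D n \<inter> cell \<phi> (V n) (K n) (insert (j n) (J n)))"
  show thesis
  proof
    show "N \<subseteq> A"
      using sub unfolding N_def cell_def by blast
  next
    have "\<exists>y\<noteq>x. y \<in> N \<and> y \<in> U" if U: "x \<in> U" "openin T U" for U
    proof -
      obtain V' K' D' where *: "open V'" "finite K'" "D' \<in> \<D>" "x \<in> D' \<inter> cell \<phi> V' K' {}"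
          "D' \<inter> cell \<phi> V' K' {} \<subseteq> U"
        using openin_T_obtains[OF U(2,1)] .
      then have "x \<in> V'" "K' \<subseteq> \<phi> x"
        by (auto simp: cell_def)
      then obtain e where e: "e > 0" "ball x e \<subseteq> V'"
        using * openE by blast
      obtain n where n: "1 / real (n + 1) < e"
        using nat_approx_posE[OF e(1)] by (metis Suc_eq_plus1)
      \<comment> \<open>The bound \<open>1 / (n + 1)\<close> controls \<open>r (Suc n)\<close>,
        hence the index shift.\<close>
      let ?m = "Suc n"
      have "V ?m \<subseteq> V'"
      proof
        fix y assume "y \<in> V ?m"
        then have "\<bar>y - x\<bar> < e"
          using VD[of y ?m] n r_Suc[of n] by linarith
        then show "y \<in> V'"
          using e by (auto simp: dist_real_def abs_minus_commute)
      qed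
      have "\<not> small ((D' \<inter> D ?m) \<inter> cell \<phi> (V ?m) (K ?m) (insert (j ?m) (J ?m)))"
        using large[OF Int_mem[OF *(3) D[of ?m]]] V[of ?m] K[of ?m] J[of ?m] KJ[of ?m] j[of ?m]
        unfolding large_def by (metis Int_insert_right_if0 UnI1 finite_insert)
      then obtain y where y: "y \<in> (D' \<inter> D ?m) \<inter> cell \<phi> (V ?m) (K ?m) (insert (j ?m) (J ?m))" "y \<noteq> x"
        by (rule not_small_obtains)
      have "y \<in> N"
        using y unfolding N_def by blast
      moreover have "y \<in> D' \<inter> cell \<phi> V' K' {}"
        using y \<open>V ?m \<subseteq> V'\<close> \<open>K' \<subseteq> \<phi> x\<close> K(2)[of ?m] unfolding cell_def by blast
      ultimately show ?thesis
        using *(5) y(2) by blast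
    qed
    then show "x \<in> T derived_set_of N"
      by (simp add: in_derived_set_of topspace_T)
  next
    fix U assume U: "openin T U" "U \<inter> N \<noteq> {}"
    then obtain y n where y: "y \<in> U" "y \<in> D n \<inter> cell \<phi> (V n) (K n) (insert (j n) (J n))"
      unfolding N_def by blast
    obtain V' K' D' where *: "open V'" "finite K'" "D' \<in> \<D>" "y \<in> D' \<inter> cell \<phi> V' K' {}"
        "D' \<inter> cell \<phi> V' K' {} \<subseteq> U"
      using openin_T_obtains[OF U(1) y(1)] .
    \<comment> \<open>Points of \<open>?W\<close> carry \<open>j n\<close>, which the
      \<open>n\<close>-th piece of \<open>N\<close> forbids; the other pieces lie over sets disjoint
      from \<open>V n\<close>.\<close>
    let ?W = "D' \<inter> cell \<phi> (V' \<inter> V n) (insert (j n) K') {}"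
    have "openin T ?W"
      using * V by (intro openin_T_basic) auto
    moreover have "?W \<subseteq> U"
      using *(5) unfolding cell_def by blast
    moreover have "?W \<inter> N = {}"
      using disj unfolding N_def cell_def by blast
    moreover have "?W \<inter> A \<noteq> {}"
    proof -
      \<comment> \<open>The label of \<open>y\<close> contains \<open>K'\<close> and avoids
        \<open>J n\<close>, so requiring \<open>K'\<close> and \<open>j n\<close> as well is
        consistent with forbidding \<open>J n\<close>.\<close>
      have "V' \<inter> V n \<noteq> {}" "(insert (j n) (K' \<union> K n)) \<inter> J n = {}"
        using y(2) *(4) j[of n] unfolding cell_def by auto
      then have "\<not> small ((D' \<inter> D n) \<inter> cell \<phi> (V' \<inter> V n) (insert (j n) (K' \<union> K n)) (J n))"
        using large[OF Int_mem[OF *(3) D[of n]]] V[of n] K[of n] J[of n] *(1,2)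
        unfolding large_def by (metis finite_Un finite_insert open_Int)
      then obtain z where "z \<in> (D' \<inter> D n) \<inter> cell \<phi> (V' \<inter> V n) (insert (j n) (K' \<union> K n)) (J n)"
        by (rule not_small_obtains)
      then have "z \<in> ?W" "z \<in> A"
        using sub[of n] unfolding cell_def by blast+
      then show ?thesis by blast
    qed
    ultimately show "\<exists>W. openin T W \<and> W \<subseteq> U \<and> W \<inter> A \<noteq> {} \<and> W \<inter> N = {}"
      by blast
  qed
qed

text \<open>The set \<open>N\<close> was compared with \<open>A\<close> alone, so it serves every
  subspace containing \<open>A\<close>: an open set meeting \<open>N\<close> contains an open
  \<open>W\<close> with points of \<open>A\<close> but none of \<open>N\<close>, and those points
  are not in the closure of \<open>N\<close>.\<close>

lemma hereditary_nowhere_dense_tightness_T: "hereditary_nowhere_dense_tightness T"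
  unfolding hereditary_nowhere_dense_tightness_def nowhere_dense_tightness_def
proof (intro allI impI)
  fix S A x
  assume "A \<subseteq> topspace (subtopology T S) \<and> x \<in> subtopology T S derived_set_of A"
  then have A: "A \<subseteq> S" and x: "x \<in> S" "x \<in> T derived_set_of A"
    by (auto simp: topspace_T derived_set_of_subtopology Int_absorb1)
  obtain N where N: "N \<subseteq> A" "x \<in> T derived_set_of N"
    and nwd: "\<And>U. openin T U \<Longrightarrow> U \<inter> N \<noteq> {} \<Longrightarrow>
       \<exists>W. openin T W \<and> W \<subseteq> U \<and> W \<inter> A \<noteq> {} \<and> W \<inter> N = {}"
    using obtains_relatively_nowhere_dense[OF x(2)] by metis
  let ?X = "subtopology T S"
  have "y \<notin> ?X interior_of (?X closure_of N)" for y
  proof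
    assume "y \<in> ?X interior_of (?X closure_of N)"
    then obtain U where U: "openin T U" "y \<in> U \<inter> S" "U \<inter> S \<subseteq> ?X closure_of N"
      unfolding interior_of_def openin_subtopology by blast
    have cl: "W \<inter> N \<noteq> {}" if "openin T W" "z \<in> W \<inter> S" "z \<in> ?X closure_of N" for W z
    proof -
      have "openin ?X (W \<inter> S)"
        using that(1) unfolding openin_subtopology by blast
      then show ?thesis
        using that unfolding in_closure_of by blast
    qed
    have "U \<inter> N \<noteq> {}"
      using cl U by blast
    then obtain W where W: "openin T W" "W \<subseteq> U" "W \<inter> A \<noteq> {}" "W \<inter> N = {}"
      using nwd[OF U(1)] by blast
    then show False
      using cl[OF W(1)] A U(3) by blast
  qed
  then have "nowhere_dense_subset ?X N"
    using N A by (auto simp: nowhere_dense_subset_def topspace_T)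
  moreover have "x \<in> ?X derived_set_of N"
    using N A x by (simp add: derived_set_of_subtopology Int_absorb1)
  ultimately show "\<exists>N\<subseteq>A. nowhere_dense_subset ?X N \<and> x \<in> ?X derived_set_of N"
    using N by blast
qed

section \<open>Uncountable disjoint families and irresolvability\<close>

text \<open>Otherwise each \<open>A i\<close> contains a trace of a cell whose open part is taken
  from a countable base. There are only countably many such cells, so two indices share one, and the
  two traces meet.\<close>

lemma ex_derived_set_empty:
  assumes disj: "disjoint_family_on A I" and "uncountable I"
  shows "\<exists>i\<in>I. T derived_set_of (A i) = {}"
proof (rule ccontr)
  assume neg: "\<not> ?thesis"
  obtain \<B> :: "real set set" where \<B>: "countable \<B>" "topological_basis \<B>"
    using ex_countable_basis by blast
  have "\<exists>V K J D. D \<in> \<D> \<and> V \<in> \<B> \<and> V \<noteq> {} \<and> finite K \<and> finite J \<and> K \<inter> J = {} \<and>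
      D \<inter> cell \<phi> V K J \<subseteq> A i" if i: "i \<in> I" for i
  proof -
    obtain x where "x \<in> T derived_set_of (A i)"
      using neg i by blast
    \<comment> \<open>The cell given by \<open>UNIV\<close> and \<open>{}\<close> is the whole
      line.\<close>
    then have "- (A i) \<notin> \<D>"
      using Compl_notin_if_derived[of x "A i" UNIV "{}"] by (simp add: cell_def)
    then obtain D V K J where D: "D \<in> \<D>" "open V" "V \<noteq> {}" "finite K" "finite J" "K \<inter> J = {}"
        "D \<inter> cell \<phi> V K J \<subseteq> A i"
      by (rule trace_if_Compl_notin)
    obtain x where "x \<in> V"
      using D by blast
    then obtain B where "B \<in> \<B>" "x \<in> B" "B \<subseteq> V"
      using topological_basisE[OF \<B>(2) D(2)] by metis
    moreover from this have "D \<inter> cell \<phi> B K J \<subseteq> A i"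
      using D(7) unfolding cell_def by blast
    moreover have "B \<noteq> {}"
      using \<open>x \<in> B\<close> by blast
    ultimately show ?thesis
      using D(1,4-6) by blast
  qed
  then obtain V K J D where VKJD: "\<And>i. i \<in> I \<Longrightarrow> D i \<in> \<D> \<and> V i \<in> \<B> \<and> V i \<noteq> {} \<and>
      finite (K i) \<and> finite (J i) \<and> K i \<inter> J i = {} \<and> D i \<inter> cell \<phi> (V i) (K i) (J i) \<subseteq> A i"
    by metis
  have inj: "inj_on (\<lambda>i. (V i, K i, J i)) I"
  proof (rule inj_onI, rule ccontr)
    fix i k assume i: "i \<in> I" and k: "k \<in> I" and eq: "(V i, K i, J i) = (V k, K k, J k)" and "i \<noteq> k"
    have "open (V i)"
      using VKJD[OF i] \<B>(2) topological_basis_open by blast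
    moreover have "large \<phi> (D i \<inter> D k)"
      using VKJD[OF i] VKJD[OF k] Int_mem large by blast
    ultimately have "\<not> small (D i \<inter> D k \<inter> cell \<phi> (V i) (K i) (J i))"
      using VKJD[OF i] unfolding large_def by blast
    then obtain y where "y \<in> D i \<inter> D k \<inter> cell \<phi> (V i) (K i) (J i)"
      by (rule not_small_obtains)
    then have "y \<in> A i \<inter> A k"
      using VKJD[OF i] VKJD[OF k] eq by auto
    then show False
      using disj i k \<open>i \<noteq> k\<close> unfolding disjoint_family_on_def by blast
  qed
  have "(\<lambda>i. (V i, K i, J i)) ` I \<subseteq> \<B> \<times> Collect finite \<times> Collect finite"
    using VKJD by auto
  moreover have "countable (\<B> \<times> Collect finite \<times> Collect finite :: (real set \<times> nat set \<times> nat set) set)"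
    using \<B>(1) by (intro countable_SIGMA countable_Collect_finite)
  ultimately have "countable ((\<lambda>i. (V i, K i, J i)) ` I)"
    by (rule countable_subset)
  then have "countable I"
    using inj by (rule countable_image_inj_on)
  with assms(2) show False ..
qed

end

lemma uncountable_Field_omega_1: "uncountable (Field omega_1)"
proof
  assume "countable (Field omega_1)"
  then have "|Field omega_1| \<le>o |UNIV :: nat set|"
    by (simp add: countable_iff_card_of_ordLeq)
  moreover have "|Field omega_1| =o omega_1"
    unfolding omega_1_def by (simp add: card_of_Field_ordIso cardSuc_Card_order natLeq_Card_order)
  ultimately have "omega_1 \<le>o natLeq"
    using card_of_nat ordIso_symmetric ordIso_ordLeq_trans ordLeq_ordIso_trans by metis
  moreover have "natLeq <o omega_1"
    unfolding omega_1_def by (simp add: cardSuc_greater natLeq_Card_order)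
  ultimately show False
    by (simp add: not_ordLess_ordLeq)
qed

text \<open>Index the dense sets by \<open>Field \<kappa>\<close>. A dense set accumulates at every
  point of any other, disjoint dense set, which none with empty derived set can do.\<close>

lemma hereditarily_irresolvable_if_derived_set_empty:
  assumes \<kappa>: "Card_order \<kappa>" "infinite (Field \<kappa>)"
    and der: "\<And>A. disjoint_family_on A (Field \<kappa>) \<Longrightarrow> \<exists>\<alpha>\<in>Field \<kappa>. X derived_set_of (A \<alpha>) = {}"
  shows "hereditarily_irresolvable \<kappa> X"
  unfolding hereditarily_irresolvable_def resolvable_def
proof (intro allI impI notI)
  fix S
  assume S: "S \<subseteq> topspace X \<and> S \<noteq> {}"
    and "\<exists>\<D>. |\<D>| =o \<kappa> \<and> disjoint \<D> \<and> (\<forall>D\<in>\<D>. dense_subset (subtopology X S) D)"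
  then obtain \<D> where \<D>: "|\<D>| =o \<kappa>" "disjoint \<D>"
    and dense: "\<And>D. D \<in> \<D> \<Longrightarrow> dense_subset (subtopology X S) D"
    by blast
  have "|Field \<kappa>| =o |\<D>|"
    using \<kappa>(1) \<D>(1) card_of_Field_ordIso ordIso_transitive ordIso_symmetric by metis
  then obtain g where g: "bij_betw g (Field \<kappa>) \<D>"
    using card_of_ordIso by blast
  have disj: "disjoint_family_on g (Field \<kappa>)"
    unfolding disjoint_family_on_def
  proof (intro ballI impI)
    fix m n assume mn: "m \<in> Field \<kappa>" "n \<in> Field \<kappa>" "m \<noteq> n"
    then have "g m \<noteq> g n" "g m \<in> \<D>" "g n \<in> \<D>"
      using g by (auto simp: bij_betw_def inj_on_def)
    then show "g m \<inter> g n = {}"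
      using \<D>(2) by (auto simp: disjoint_def)
  qed
  then obtain a where a: "a \<in> Field \<kappa>" "X derived_set_of (g a) = {}"
    using der by blast
  \<comment> \<open>An infinite index set provides a second dense set, whose points lie outside
    \<open>g a\<close>.\<close>
  obtain b where b: "b \<in> Field \<kappa>" "b \<noteq> a"
    using \<kappa>(2) by (metis finite.emptyI finite.insertI finite_subset insertI1 subsetI)
  have ga: "dense_subset (subtopology X S) (g a)" and gb: "dense_subset (subtopology X S) (g b)"
    using g a b dense by (auto simp: bij_betw_def)
  have "g b \<noteq> {}"
    using gb S by (auto simp: dense_subset_def)
  then obtain x where x: "x \<in> g b" by blast
  then have "x \<notin> g a"
    using disj a b unfolding disjoint_family_on_def by blast
  moreover have "x \<in> subtopology X S closure_of (g a)"
    using x ga gb by (auto simp: dense_subset_def)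
  ultimately have "x \<in> subtopology X S derived_set_of (g a)"
    by (simp add: closure_of_alt)
  then have "x \<in> X derived_set_of (g a)"
    by (metis IntD2 Int_lower2 derived_set_of_mono derived_set_of_subtopology subset_iff)
  with a show False by blast
qed

theorem mainTheorem1:
  shows "\<exists>T :: real topology.
    topspace T = UNIV \<and>
    (\<forall>U. openin euclideanreal U \<longrightarrow> openin T U) \<and>
    dispersion_character T =o continuum \<and>
    hereditary_nowhere_dense_tightness T \<and>
    hereditarily_irresolvable omega_1 T \<and>
    (\<forall>A :: nat set \<Rightarrow> real set. disjoint_family_on A (Field omega_1) \<longrightarrow>
       (\<exists>\<alpha>\<in>Field omega_1. T derived_set_of (A \<alpha>) = {}))"
proof -
  obtain \<phi> :: "real \<Rightarrow> nat set" where \<phi>: "\<And>x. finite (\<phi> x)"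
      "\<And>K V. finite K \<Longrightarrow> open V \<Longrightarrow> V \<noteq> {} \<Longrightarrow> \<not> small {x \<in> V. \<phi> x = K}"
    using ex_labelling_finite_sets by blast
  \<comment> \<open>Points labelled exactly \<open>K\<close> lie in the cell because
    \<open>K\<close> and \<open>J\<close> are disjoint; this starts the Zorn argument.\<close>
  have "large \<phi> UNIV"
    unfolding large_def
  proof (intro allI impI, elim conjE)
    fix V :: "real set" and K J :: "nat set"
    assume *: "open V" "V \<noteq> {}" "finite K" "K \<inter> J = {}"
    then have "{x \<in> V. \<phi> x = K} \<subseteq> UNIV \<inter> cell \<phi> V K J"
      by (auto simp: cell_def)
    then show "\<not> small (UNIV \<inter> cell \<phi> V K J)"
      using \<phi>(2) * small_subset by blast
  qed
  then obtain \<D> where "\<forall>D\<in>\<D>. large \<phi> D" "\<forall>D\<in>\<D>. \<forall>E\<in>\<D>. D \<inter> E \<in> \<D>"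
      "\<forall>E. (\<forall>D\<in>\<D>. large \<phi> (E \<inter> D)) \<longrightarrow> E \<in> \<D>"
    using ex_maximal_filter[of "large \<phi>"] by metis
  then interpret fine_topology \<phi> \<D>
    using \<phi>(1) by unfold_locales blast+
  have derived: "\<exists>\<alpha>\<in>Field omega_1. T derived_set_of (A \<alpha>) = {}"
    if "disjoint_family_on A (Field omega_1)" for A :: "nat set \<Rightarrow> real set"
    using that uncountable_Field_omega_1 by (rule ex_derived_set_empty)
  have "Card_order omega_1" "infinite (Field omega_1)"
    using uncountable_Field_omega_1 countable_finite
    by (auto simp: omega_1_def cardSuc_Card_order natLeq_Card_order)
  then have "hereditarily_irresolvable omega_1 T"
    using derived by (rule hereditarily_irresolvable_if_derived_set_empty)
  then show ?thesis
    using topspace_T openin_T_open dispersion_character_T hereditary_nowhere_dense_tightness_T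
      derived by (intro exI[of _ T]) simp
qed

end
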